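(* Let $c\in\omega$, $c\ge 0$. There is no effective enumeration of $\mathcal{R}_{[0,c]}$, the family of all Martin-Löf random left-c.e. reals whose optimal randomness constant belongs to $[0,c]$.
   Context: $\mathbb{Q}_2=\{a/2^b\le 1 : a,b\in\omega\}$ is the set of dyadic rationals. For $q\in\mathbb{Q}_2$ and a real $x\in 2^\omega$, $q<x$ means that $q$ is less than the real number $\sum_{i\in\omega}x(i)2^{-(i+1)}$. A real $x\in 2^\omega$ is left-c.e. if $\{q\in\mathbb{Q}_2: q<x\}$ is computably enumerable. An effective numbering (also called effective enumeration) of a family $\mathcal{R}$ of left-c.e. reals is a map $r:\omega\to\mathcal{R}$ that is onto $\mathcal{R}$ and such that $\{(q,e)\in\mathbb{Q}_2\times\omega : q<r(e)\}$ is computably enumerable. $K$ denotes prefix-free Kolmogorov complexity (with respect to a fixed universal prefix-free machine); by Schnorr's Theorem, $x\in 2^\omega$ is Martin-Löf random if and only if there is a constant $c$ such that $K(x\upharpoonright n)\ge n-c$ for all $n$. The optimal randomness constant of a Martin-Löf random $x$ is the least $c\in\omega$ for which this holds. For an interval $I\subseteq\omega$, $\mathcal{R}_I$ is the set of all Martin-Löf random left-c.e. reals whose optimal randomness constant belongs to $I$; thus $\mathcal{R}_{[0,c]}$ is the set of left-c.e. reals $x$ with $K(x\upharpoonright n)\ge n-c$ for all $n$. *)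

theory Defs
  imports Complex_Main "HOL-Library.Nat_Bijection" "HOL-Library.Extended_Nat"
    "HOL-Library.Sublist"
begin

subsection \<open>Partial recursive functions and c.e. sets\<close>

text \<open>
  Unbounded search: the least \<open>n\<close> with \<open>f \<langle>a, n\<rangle> = 0\<close>, provided that \<open>f \<langle>a, m\<rangle>\<close>
  is defined for all smaller \<open>m\<close>; undefined otherwise.
\<close>

definition mu_search :: "(nat \<Rightarrow> nat option) \<Rightarrow> nat \<Rightarrow> nat option" where
  "mu_search f a =
     (if \<exists>n. f (prod_encode (a, n)) = Some 0 \<and> (\<forall>m<n. f (prod_encode (a, m)) \<noteq> None)
      then Some (LEAST n. f (prod_encode (a, n)) = Some 0) else None)"

text \<open>
  Kleene's partial recursive functions, in the unary presentation: functions of several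
  arguments are functions of one argument via the Cantor pairing function \<^const>\<open>prod_encode\<close>.
\<close>

inductive partial_recursive :: "(nat \<Rightarrow> nat option) \<Rightarrow> bool" where
  zero: "partial_recursive (\<lambda>_. Some 0)"
| succ: "partial_recursive (\<lambda>n. Some (Suc n))"
| left: "partial_recursive (\<lambda>n. Some (fst (prod_decode n)))"
| right: "partial_recursive (\<lambda>n. Some (snd (prod_decode n)))"
| pair: "partial_recursive f \<Longrightarrow> partial_recursive g \<Longrightarrow>
    partial_recursive
      (\<lambda>n. Option.bind (f n) (\<lambda>u. Option.bind (g n) (\<lambda>v. Some (prod_encode (u, v)))))"
| comp: "partial_recursive f \<Longrightarrow> partial_recursive g \<Longrightarrow>
    partial_recursive (\<lambda>n. Option.bind (g n) f)"
| prec: "partial_recursive f \<Longrightarrow> partial_recursive g \<Longrightarrow>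
    partial_recursive (\<lambda>n. case prod_decode n of (a, k) \<Rightarrow>
      rec_nat (f a)
        (\<lambda>i acc. Option.bind acc (\<lambda>v. g (prod_encode (a, prod_encode (i, v))))) k)"
| mu: "partial_recursive f \<Longrightarrow> partial_recursive (mu_search f)"

definition ce :: "nat set \<Rightarrow> bool" where
  "ce A \<longleftrightarrow> (\<exists>f. partial_recursive f \<and> A = dom f)"


subsection \<open>Prefix-free machines and Kolmogorov complexity\<close>

text \<open>The usual bijection between binary strings and natural numbers (bijective base 2).\<close>

fun str_code :: "bool list \<Rightarrow> nat" where
  "str_code [] = 0"
| "str_code (b # \<sigma>) = 2 * str_code \<sigma> + (if b then 2 else 1)"

lemma bij_str_code: "bij str_code"
proof (rule bijI)
  show "inj str_code"
  proof (rule injI)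
    show "\<sigma> = \<tau>" if "str_code \<sigma> = str_code \<tau>" for \<sigma> \<tau>
      using that
    proof (induction \<sigma> arbitrary: \<tau>)
      case Nil
      then show ?case by (cases \<tau>) (auto split: if_splits)
    next
      case (Cons b \<sigma>)
      then obtain b' \<tau>' where \<tau>: "\<tau> = b' # \<tau>'"
        by (cases \<tau>) (auto split: if_splits)
      have "b = b' \<and> str_code \<sigma> = str_code \<tau>'"
        using Cons.prems unfolding \<tau> by (cases b; cases b'; simp; presburger)
      then show ?case using Cons.IH \<tau> by auto
    qed
  qed
  have "\<exists>\<sigma>. n = str_code \<sigma>" for n
  proof (induction n rule: less_induct)
    case (less n)
    show ?case
    proof (cases "n = 0")
      case True
      then show ?thesis by (intro exI[of _ "[]"]) simp
    next
      case False
      define m where "m = (n - 1) div 2"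
      have "m < n" using False by (simp add: m_def)
      then obtain \<sigma> where \<sigma>: "m = str_code \<sigma>" using less by blast
      have "n = str_code (even n # \<sigma>)"
        using False by (auto simp: \<sigma>[symmetric] m_def elim!: evenE oddE)
      then show ?thesis by blast
    qed
  qed
  then show "surj str_code" by (auto simp: surj_def)
qed

definition computable_str :: "(bool list \<Rightarrow> bool list option) \<Rightarrow> bool" where
  "computable_str M \<longleftrightarrow>
     (\<exists>f. partial_recursive f \<and> (\<forall>\<sigma>. f (str_code \<sigma>) = map_option str_code (M \<sigma>)))"

definition prefix_free_machine :: "(bool list \<Rightarrow> bool list option) \<Rightarrow> bool" where
  "prefix_free_machine M \<longleftrightarrow> computable_str M \<and>
     (\<forall>\<sigma>\<in>dom M. \<forall>\<tau>\<in>dom M. prefix \<sigma> \<tau> \<longrightarrow> \<sigma> = \<tau>)"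

text \<open>
  The complexity of a string with respect to a machine is the length of a shortest description;
  it is \<open>\<infinity>\<close> for strings outside the range of the machine.
\<close>

definition K :: "(bool list \<Rightarrow> bool list option) \<Rightarrow> bool list \<Rightarrow> enat" where
  "K M \<sigma> = (INF \<tau>\<in>{\<tau>. M \<tau> = Some \<sigma>}. enat (length \<tau>))"

text \<open>
  Universality is taken in the sense of the invariance theorem (additive optimality). Machines
  that simulate every prefix-free machine \<open>M\<close> by adjunction, \<open>U (\<rho>\<^sub>M @ \<sigma>) = M \<sigma>\<close>,
  are a special case.
\<close>

definition universal_prefix_free :: "(bool list \<Rightarrow> bool list option) \<Rightarrow> bool" where
  "universal_prefix_free U \<longleftrightarrow> prefix_free_machine U \<and>
     (\<forall>M. prefix_free_machine M \<longrightarrow> (\<exists>d::nat. \<forall>\<sigma>. K U \<sigma> \<le> K M \<sigma> + enat d))"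


subsection \<open>Left-c.e. reals and effective numberings\<close>

definition real_of_seq :: "(nat \<Rightarrow> bool) \<Rightarrow> real" where
  "real_of_seq x = (\<Sum>i. of_bool (x i) / 2 ^ (i + 1))"

definition dyadics :: "real set" where
  "dyadics = {q. q \<le> 1 \<and> (\<exists>a b :: nat. q = real a / 2 ^ b)}"

text \<open>
  A number \<open>n\<close> names the dyadic rational \<open>a / 2 ^ b\<close>, where \<open>n\<close> codes the pair \<open>(a, b)\<close>.
  A set of dyadic rationals, or of pairs of a dyadic rational and a natural number, is c.e. if
  the set of all names of its elements is.
\<close>

definition dyadic_of :: "nat \<Rightarrow> real" where
  "dyadic_of n = (case prod_decode n of (a, b) \<Rightarrow> real a / 2 ^ b)"

definition ce_dyadic :: "real set \<Rightarrow> bool" where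
  "ce_dyadic A \<longleftrightarrow> ce {n. dyadic_of n \<in> A}"

definition ce_dyadic_nat :: "(real \<times> nat) set \<Rightarrow> bool" where
  "ce_dyadic_nat A \<longleftrightarrow> ce {prod_encode (n, e) | n e. (dyadic_of n, e) \<in> A}"

definition left_ce :: "(nat \<Rightarrow> bool) \<Rightarrow> bool" where
  "left_ce x \<longleftrightarrow> ce_dyadic {q \<in> dyadics. q < real_of_seq x}"

definition effective_numbering :: "(nat \<Rightarrow> nat \<Rightarrow> bool) \<Rightarrow> (nat \<Rightarrow> bool) set \<Rightarrow> bool" where
  "effective_numbering r R \<longleftrightarrow> range r = R \<and>
     ce_dyadic_nat {(q, e). q \<in> dyadics \<and> q < real_of_seq (r e)}"


subsection \<open>Random left-c.e. reals with bounded randomness constant\<close>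

text \<open>The condition \<open>K (x \<restriction> n) \<ge> n - c\<close> for all \<open>n\<close>, free of truncated subtraction.\<close>

definition randomness_constant ::
    "(bool list \<Rightarrow> bool list option) \<Rightarrow> (nat \<Rightarrow> bool) \<Rightarrow> nat \<Rightarrow> bool" where
  "randomness_constant U x c \<longleftrightarrow> (\<forall>n. enat n \<le> K U (map x [0..<n]) + enat c)"

text \<open>
  Martin-Loef randomness in the Levin--Chaitin form; by Schnorr's theorem it does not depend
  on the universal machine \<open>U\<close> and agrees with passing all Martin-Loef tests.
\<close>

definition ml_random :: "(bool list \<Rightarrow> bool list option) \<Rightarrow> (nat \<Rightarrow> bool) \<Rightarrow> bool" where
  "ml_random U x \<longleftrightarrow> (\<exists>c. randomness_constant U x c)"

definition optimal_constant ::
    "(bool list \<Rightarrow> bool list option) \<Rightarrow> (nat \<Rightarrow> bool) \<Rightarrow> nat" where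
  "optimal_constant U x = (LEAST c. randomness_constant U x c)"

definition random_left_ce ::
    "(bool list \<Rightarrow> bool list option) \<Rightarrow> nat set \<Rightarrow> (nat \<Rightarrow> bool) set" where
  "random_left_ce U I = {x. left_ce x \<and> ml_random U x \<and> optimal_constant U x \<in> I}"

end

theory Submission imports Defs begin

text \<open>
  Let \<open>S\<close> be the set of reals whose binary expansions satisfy the randomness condition with
  constant \<open>c\<close>. By compactness, an interval misses \<open>S\<close> iff finitely many dyadic intervals of
  compressible strings cover it, which is a semidecidable condition; hence the reals above
  \<open>max S\<close> are effectively enumerable, and the least element of \<open>S\<close> above a given dyadic
  rational is left-c.e. If the left-c.e. members of \<open>S\<close> had an effective numbering, the dyadic
  rationals below \<open>max S\<close> would be enumerable as well, so \<open>max S\<close> would be both computable and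
  random.
\<close>

subsection \<open>Recursive functions\<close>

text \<open>The upper cut of \<open>max S\<close> is enumerable unconditionally, so
  \<open>max S\<close> is itself never left-c.e.; a numbering can only approach it from below. It
  does so because the left-c.e. members of \<open>S\<close> are cofinal: above each dyadic rational
  smaller than \<open>max S\<close> there is one. The main obstacle is the passage from sequences to
  reals. Compressibility concerns strings, cuts concern reals, and a dyadic real has two expansions.
  What removes it is that no member of \<open>S\<close> is dyadic: members lie strictly inside their
  dyadic intervals, covers may use closed intervals that merely touch, and weak and strict
  comparison with dyadic rationals agree on \<open>S\<close>. Enumerability is handled through
  predicates with one unbounded existential quantifier over a decidable matrix, so that closure
  rules take the place of explicit programs.\<close>

abbreviation pfst :: "nat \<Rightarrow> nat" where "pfst n \<equiv> fst (prod_decode n)"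
abbreviation psnd :: "nat \<Rightarrow> nat" where "psnd n \<equiv> snd (prod_decode n)"

definition recursive :: "(nat \<Rightarrow> nat) \<Rightarrow> bool" where
  "recursive f \<longleftrightarrow> partial_recursive (\<lambda>n. Some (f n))"

named_theorems computability

lemma recursive_comp: "recursive f \<Longrightarrow> recursive g \<Longrightarrow> recursive (\<lambda>n. f (g n))"
  using comp[of "\<lambda>n. Some (f n)" "\<lambda>n. Some (g n)"] by (simp add: recursive_def)

lemma recursive_pair [computability]:
  "recursive f \<Longrightarrow> recursive g \<Longrightarrow> recursive (\<lambda>n. prod_encode (f n, g n))"
  using pair[of "\<lambda>n. Some (f n)" "\<lambda>n. Some (g n)"] by (simp add: recursive_def)

lemma recursive_pfst [computability]: "recursive f \<Longrightarrow> recursive (\<lambda>n. pfst (f n))"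
  using recursive_comp[of pfst f] left by (simp add: recursive_def)

lemma recursive_psnd [computability]: "recursive f \<Longrightarrow> recursive (\<lambda>n. psnd (f n))"
  using recursive_comp[of psnd f] right by (simp add: recursive_def)

lemma recursive_Suc [computability]: "recursive f \<Longrightarrow> recursive (\<lambda>n. Suc (f n))"
  using recursive_comp[of Suc f] succ by (simp add: recursive_def)

lemma recursive_id [computability]: "recursive (\<lambda>n. n)"
  using recursive_pair[of pfst psnd] left right by (simp add: recursive_def)

lemma recursive_const [computability]: "recursive (\<lambda>_. k)"
proof (induction k)
  case 0
  then show ?case using zero by (simp add: recursive_def)
next
  case (Suc k)
  then show ?case by (rule recursive_Suc)
qed

text \<open>The scheme \<open>prec\<close> hands its parameter to the step function. Feeding it the
  pair of \<open>n\<close> and \<open>k n\<close> lets start, step and length all depend on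
  \<open>n\<close>.\<close>

lemma recursive_rec_nat:
  assumes "recursive (\<lambda>m. G (pfst m) (pfst (psnd m)) (psnd (psnd m)))"
    and "recursive a" "recursive k"
  shows "recursive (\<lambda>n. rec_nat (a n) (G n) (k n))"
proof -
  let ?g = "\<lambda>m. G (pfst m) (pfst (psnd m)) (psnd (psnd m))"
  have eq: "rec_nat (Some (a b))
      (\<lambda>i acc. Option.bind acc (\<lambda>v. Some (?g (prod_encode (b, prod_encode (i, v)))))) j
    = Some (rec_nat (a b) (G b) j)" for b j
    by (induction j) auto
  have "recursive (\<lambda>m. rec_nat (a (pfst m)) (G (pfst m)) (psnd m))"
    using prec[OF assms(2,1)[unfolded recursive_def]] eq
    by (simp add: recursive_def case_prod_beta)
  from recursive_comp[OF this recursive_pair[OF recursive_id assms(3)]]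
  show ?thesis by simp
qed

lemma recursive_add [computability]:
  assumes "recursive f" "recursive g" shows "recursive (\<lambda>n. f n + g n)"
proof -
  have "rec_nat a (\<lambda>_. Suc) b = a + b" for a b
    by (induction b) auto
  with recursive_rec_nat[where G = "\<lambda>_ _. Suc", OF _ assms] show ?thesis
    by (simp add: computability)
qed

lemma recursive_mult [computability]:
  assumes "recursive f" "recursive g" shows "recursive (\<lambda>n. f n * g n)"
proof -
  have "rec_nat 0 (\<lambda>_ v. v + a) b = a * b" for a b :: nat
    by (induction b) auto
  moreover have "recursive (\<lambda>n. rec_nat 0 (\<lambda>_ v. v + f n) (g n))"
    by (intro recursive_rec_nat computability recursive_comp[OF assms(1)] assms)
  ultimately show ?thesis by simp
qed

lemma recursive_power [computability]:
  assumes "recursive f" "recursive g" shows "recursive (\<lambda>n. f n ^ g n)"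
proof -
  have "rec_nat 1 (\<lambda>_ v. v * a) b = a ^ b" for a b :: nat
    by (induction b) auto
  moreover have "recursive (\<lambda>n. rec_nat 1 (\<lambda>_ v. v * f n) (g n))"
    by (intro recursive_rec_nat computability recursive_comp[OF assms(1)] assms)
  ultimately show ?thesis by simp
qed

lemma recursive_diff:
  assumes "recursive f" "recursive g" shows "recursive (\<lambda>n. f n - g n)"
proof -
  have pred: "recursive (\<lambda>n. n - 1)"
  proof -
    have "rec_nat 0 (\<lambda>i _. i) n = n - 1" for n by (cases n) auto
    moreover have "recursive (\<lambda>n. rec_nat 0 (\<lambda>i _. i) n)"
      by (intro recursive_rec_nat computability)
    ultimately show ?thesis by simp
  qed
  have "rec_nat a (\<lambda>_ v. v - 1) b = a - b" for a b :: nat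
    by (induction b) auto
  moreover have "recursive (\<lambda>n. rec_nat (f n) (\<lambda>_ v. v - 1) (g n))"
    by (intro recursive_rec_nat computability recursive_comp[OF pred] assms)
  ultimately show ?thesis by simp
qed

lemma recursive_if_zero:
  assumes "recursive h" "recursive f" "recursive g"
  shows "recursive (\<lambda>n. if h n = 0 then f n else g n)"
proof -
  have "rec_nat a (\<lambda>_ _. b) k = (if k = 0 then a else b)" for a b k :: nat
    by (cases k) auto
  moreover have "recursive (\<lambda>n. rec_nat (f n) (\<lambda>_ _. g n) (h n))"
    by (intro recursive_rec_nat computability recursive_comp[OF assms(3)] assms)
  ultimately show ?thesis by simp
qed

subsection \<open>Decidable predicates\<close>

text \<open>The characteristic function vanishes on the predicate, as \<^const>\<open>mu_search\<close> looks for zeros.\<close>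

definition decidable :: "(nat \<Rightarrow> bool) \<Rightarrow> bool" where
  "decidable P \<longleftrightarrow> recursive (\<lambda>n. if P n then 0 else 1)"

lemma decidable_eq_0: "recursive f \<Longrightarrow> decidable (\<lambda>n. f n = 0)"
  unfolding decidable_def by (intro recursive_if_zero recursive_const)

lemma decidable_comp: "decidable P \<Longrightarrow> recursive f \<Longrightarrow> decidable (\<lambda>n. P (f n))"
  unfolding decidable_def by (rule recursive_comp)

lemma decidable_comp2:
  "decidable (\<lambda>m. P (pfst m) (psnd m)) \<Longrightarrow> recursive f \<Longrightarrow> recursive g \<Longrightarrow> decidable (\<lambda>n. P (f n) (g n))"
  using decidable_comp[OF _ recursive_pair, of "\<lambda>m. P (pfst m) (psnd m)" f g] by simp

lemma decidable_conj [computability]: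
  assumes "decidable P" "decidable Q" shows "decidable (\<lambda>n. P n \<and> Q n)"
proof -
  have "decidable (\<lambda>n. (if P n then 0 else 1) + (if Q n then 0 else 1) = (0::nat))"
    by (intro decidable_eq_0 recursive_add assms[unfolded decidable_def])
  then show ?thesis by (rule back_subst[of decidable]) auto
qed

lemma decidable_disj [computability]:
  assumes "decidable P" "decidable Q" shows "decidable (\<lambda>n. P n \<or> Q n)"
proof -
  have "decidable (\<lambda>n. (if P n then 0 else 1) * (if Q n then 0 else 1) = (0::nat))"
    by (intro decidable_eq_0 recursive_mult assms[unfolded decidable_def])
  then show ?thesis by (rule back_subst[of decidable]) auto
qed

lemma decidable_le [computability]:
  assumes "recursive f" "recursive g" shows "decidable (\<lambda>n. f n \<le> g n)"
  using decidable_eq_0[OF recursive_diff[OF assms]] by simp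

lemma decidable_less [computability]:
  assumes "recursive f" "recursive g" shows "decidable (\<lambda>n. f n < g n)"
  using decidable_le[OF recursive_Suc[OF assms(1)] assms(2)] by (simp add: Suc_le_eq)

lemma decidable_eq [computability]:
  assumes "recursive f" "recursive g" shows "decidable (\<lambda>n. f n = g n)"
  using decidable_conj[OF decidable_le[OF assms] decidable_le[OF assms(2,1)]]
  by (simp add: eq_iff)

text \<open>The recursion counts the indices at which the predicate fails; the count is zero iff
  there are none.\<close>

lemma decidable_bounded_all:
  assumes "decidable (\<lambda>m. P (pfst m) (psnd m))" "recursive k"
  shows "decidable (\<lambda>n. \<forall>i<k n. P n i)"
proof -
  have "rec_nat 0 (\<lambda>i v. (if Q i then 0 else 1) + v) j = (0::nat) \<longleftrightarrow> (\<forall>i<j. Q i)"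
    for Q and j :: nat
    by (induction j) (auto simp: less_Suc_eq)
  moreover have "decidable (\<lambda>n. rec_nat 0 (\<lambda>i v. (if P n i then 0 else 1) + v) (k n) = (0::nat))"
    by (intro decidable_eq_0 recursive_rec_nat recursive_add assms(2) computability
        decidable_comp2[OF assms(1), unfolded decidable_def])
  ultimately show ?thesis by simp
qed

subsection \<open>Semidecidable predicates\<close>

text \<open>The projection form of enumerability: closure proofs only have to recombine witnesses.
  Agreement with \<open>ce\<close> is \<open>ce_iff_semidecidable\<close>.\<close>

definition semidecidable :: "(nat \<Rightarrow> bool) \<Rightarrow> bool" where
  "semidecidable P \<longleftrightarrow> (\<exists>Q. decidable (\<lambda>m. Q (pfst m) (psnd m)) \<and> (\<forall>n. P n \<longleftrightarrow> (\<exists>w. Q n w)))"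

lemma semidecidableI:
  assumes "decidable (\<lambda>m. Q (pfst m) (psnd m))" "\<And>n. P n \<longleftrightarrow> (\<exists>w. Q n w)"
  shows "semidecidable P"
  using assms unfolding semidecidable_def by blast

lemma semidecidable_decidable [computability]:
  assumes "decidable P" shows "semidecidable P"
  by (rule semidecidableI[where Q = "\<lambda>n w. P n"])
    (simp_all add: decidable_comp[OF assms] computability)

lemma semidecidable_comp:
  assumes "semidecidable P" "recursive f" shows "semidecidable (\<lambda>n. P (f n))"
proof -
  obtain Q where Q: "decidable (\<lambda>m. Q (pfst m) (psnd m))" "\<And>n. P n \<longleftrightarrow> (\<exists>w. Q n w)"
    using assms(1) unfolding semidecidable_def by blast
  show ?thesis
  proof (rule semidecidableI[where Q = "\<lambda>n w. Q (f n) w"])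
    show "decidable (\<lambda>m. Q (f (pfst m)) (psnd m))"
      by (intro decidable_comp2[OF Q(1)] recursive_comp[OF assms(2)] computability)
  qed (simp add: Q(2))
qed

lemma semidecidable_comp2:
  "semidecidable (\<lambda>m. P (pfst m) (psnd m)) \<Longrightarrow> recursive f \<Longrightarrow> recursive g \<Longrightarrow>
    semidecidable (\<lambda>n. P (f n) (g n))"
  using semidecidable_comp[OF _ recursive_pair, of "\<lambda>m. P (pfst m) (psnd m)" f g] by simp

text \<open>Two unbounded quantifiers merge into one over codes of pairs.\<close>

lemma semidecidable_ex [computability]:
  assumes "semidecidable (\<lambda>m. P (pfst m) (psnd m))"
  shows "semidecidable (\<lambda>n. \<exists>v. P n v)"
proof -
  obtain Q where Q: "decidable (\<lambda>m. Q (pfst m) (psnd m))"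
    "\<And>m. P (pfst m) (psnd m) \<longleftrightarrow> (\<exists>w. Q m w)"
    using assms unfolding semidecidable_def by blast
  have P: "P n v \<longleftrightarrow> (\<exists>w. Q (prod_encode (n, v)) w)" for n v
    using Q(2)[of "prod_encode (n, v)"] by simp
  show ?thesis
  proof (rule semidecidableI[where Q = "\<lambda>n w. Q (prod_encode (n, pfst w)) (psnd w)"])
    show "decidable (\<lambda>m. Q (prod_encode (pfst m, pfst (psnd m))) (psnd (psnd m)))"
      by (intro decidable_comp2[OF Q(1)] computability)
    show "(\<exists>v. P n v) \<longleftrightarrow> (\<exists>w. Q (prod_encode (n, pfst w)) (psnd w))" for n
      unfolding P by (metis fst_conv prod_encode_inverse snd_conv)
  qed
qed

lemma semidecidable_conj [computability]:
  assumes "semidecidable P" "semidecidable Q" shows "semidecidable (\<lambda>n. P n \<and> Q n)"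
proof -
  obtain P' Q' where *: "decidable (\<lambda>m. P' (pfst m) (psnd m))" "\<And>n. P n \<longleftrightarrow> (\<exists>w. P' n w)"
    "decidable (\<lambda>m. Q' (pfst m) (psnd m))" "\<And>n. Q n \<longleftrightarrow> (\<exists>w. Q' n w)"
    using assms unfolding semidecidable_def by blast
  have "semidecidable (\<lambda>n. \<exists>v w. P' n v \<and> Q' n w)"
    by (intro semidecidable_ex semidecidable_decidable decidable_conj computability
        decidable_comp2[OF *(1)] decidable_comp2[OF *(3)])
  then show ?thesis by (simp add: *)
qed

lemma semidecidable_disj [computability]:
  assumes "semidecidable P" "semidecidable Q" shows "semidecidable (\<lambda>n. P n \<or> Q n)"
proof -
  obtain P' Q' where *: "decidable (\<lambda>m. P' (pfst m) (psnd m))" "\<And>n. P n \<longleftrightarrow> (\<exists>w. P' n w)"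
    "decidable (\<lambda>m. Q' (pfst m) (psnd m))" "\<And>n. Q n \<longleftrightarrow> (\<exists>w. Q' n w)"
    using assms unfolding semidecidable_def by blast
  have "semidecidable (\<lambda>n. \<exists>w. P' n w \<or> Q' n w)"
    by (intro semidecidable_ex semidecidable_decidable decidable_disj *)
  then show ?thesis by (simp add: * ex_disj_distrib)
qed

text \<open>A number codes a sequence through iterated unpairing; its tail beyond any finite part
  is arbitrary.\<close>

definition nth_code :: "nat \<Rightarrow> nat \<Rightarrow> nat" where
  "nth_code w i = pfst ((psnd ^^ i) w)"

lemma recursive_nth_code [computability]:
  assumes "recursive f" "recursive g" shows "recursive (\<lambda>n. nth_code (f n) (g n))"
proof -
  have "rec_nat w (\<lambda>_. psnd) i = (psnd ^^ i) w" for w i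
    by (induction i) auto
  moreover have "recursive (\<lambda>n. pfst (rec_nat (f n) (\<lambda>_. psnd) (g n)))"
    by (intro recursive_rec_nat computability assms)
  ultimately show ?thesis by (simp add: nth_code_def)
qed

lemma nth_code_exists: "\<exists>w. \<forall>i<n. nth_code w i = g i"
proof (induction n arbitrary: g)
  case (Suc n)
  obtain w where w: "\<And>i. i < n \<Longrightarrow> nth_code w i = g (Suc i)"
    using Suc[of "\<lambda>i. g (Suc i)"] by blast
  have "nth_code (prod_encode (g 0, w)) i = g i" if "i < Suc n" for i
    using w that by (cases i) (simp_all add: nth_code_def funpow_Suc_right del: funpow.simps(2))
  then show ?case by blast
qed simp

text \<open>Finitely many witnesses, one per index, are packed into a single sequence code.\<close>

lemma semidecidable_bounded_all [computability]:
  assumes "semidecidable (\<lambda>m. P (pfst m) (psnd m))" "recursive k"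
  shows "semidecidable (\<lambda>n. \<forall>i<k n. P n i)"
proof -
  obtain Q where Q: "decidable (\<lambda>m. Q (pfst m) (psnd m))"
    "\<And>m. P (pfst m) (psnd m) \<longleftrightarrow> (\<exists>w. Q m w)"
    using assms unfolding semidecidable_def by blast
  have P: "P n v \<longleftrightarrow> (\<exists>w. Q (prod_encode (n, v)) w)" for n v
    using Q(2)[of "prod_encode (n, v)"] by simp
  have "(\<forall>i<k n. P n i) \<longleftrightarrow> (\<exists>w. \<forall>i<k n. Q (prod_encode (n, i)) (nth_code w i))" for n
  proof
    assume "\<forall>i<k n. P n i"
    then obtain g where "\<forall>i<k n. Q (prod_encode (n, i)) (g i)" unfolding P by metis
    moreover obtain w where "\<forall>i<k n. nth_code w i = g i" using nth_code_exists by blast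
    ultimately show "\<exists>w. \<forall>i<k n. Q (prod_encode (n, i)) (nth_code w i)"
      by (intro exI[of _ w]) simp
  qed (auto simp: P)
  moreover have "semidecidable (\<lambda>n. \<exists>w. \<forall>i<k n. Q (prod_encode (n, i)) (nth_code w i))"
    by (intro semidecidable_ex semidecidable_decidable decidable_bounded_all
        decidable_comp2[OF Q(1)] recursive_comp[OF assms(2)] computability)
  ultimately show ?thesis by simp
qed

text \<open>A finite path, coded as a sequence, witnesses reachability. This serves both for reading
  strings bit by bit and for chains of intervals.\<close>

lemma semidecidable_rtrancl:
  assumes "semidecidable (\<lambda>m. R (pfst m) (psnd m))" "recursive f" "recursive g"
  shows "semidecidable (\<lambda>n. R\<^sup>*\<^sup>* (f n) (g n))"
proof -
  have eq: "R\<^sup>*\<^sup>* x y \<longleftrightarrow>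
      (\<exists>n w. nth_code w 0 = x \<and> nth_code w n = y \<and> (\<forall>i<n. R (nth_code w i) (nth_code w (Suc i))))"
    for x y
  proof
    assume "R\<^sup>*\<^sup>* x y"
    then obtain n h where h: "h 0 = x" "h n = y" "\<forall>i<n. R (h i) (h (Suc i))"
      unfolding rtranclp_power relpowp_fun_conv by blast
    obtain w where "\<forall>i<Suc n. nth_code w i = h i" using nth_code_exists by blast
    with h show "\<exists>n w. nth_code w 0 = x \<and> nth_code w n = y
        \<and> (\<forall>i<n. R (nth_code w i) (nth_code w (Suc i)))"
      by (intro exI[of _ n] exI[of _ w]) auto
  next
    assume "\<exists>n w. nth_code w 0 = x \<and> nth_code w n = y
        \<and> (\<forall>i<n. R (nth_code w i) (nth_code w (Suc i)))"
    then show "R\<^sup>*\<^sup>* x y" unfolding rtranclp_power relpowp_fun_conv by blast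
  qed
  show ?thesis unfolding eq
    by (intro semidecidable_comp2[OF assms(1)] recursive_comp[OF assms(2)] recursive_comp[OF assms(3)] computability)
qed

text \<open>A value of a partial recursive function is certified by a finite computation history,
  built up along the generating schemes.\<close>

lemma semidecidable_graph:
  "partial_recursive f \<Longrightarrow> semidecidable (\<lambda>m. f (pfst m) = Some (psnd m))"
proof (induction rule: partial_recursive.induct)
  case zero
  have "semidecidable (\<lambda>m. 0 = psnd m)" by (intro computability)
  then show ?case by simp
next
  case succ
  have "semidecidable (\<lambda>m. Suc (pfst m) = psnd m)" by (intro computability)
  then show ?case by simp
next
  case left
  have "semidecidable (\<lambda>m. pfst (pfst m) = psnd m)" by (intro computability)
  then show ?case by simp
next
  case right
  have "semidecidable (\<lambda>m. psnd (pfst m) = psnd m)" by (intro computability)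
  then show ?case by simp
next
  case (pair f g)
  note fg = pair.IH[THEN semidecidable_comp2]
  have "semidecidable (\<lambda>m. \<exists>u v. f (pfst m) = Some u \<and> g (pfst m) = Some v
      \<and> prod_encode (u, v) = psnd m)"
    by (intro computability fg)
  then show ?case by (rule back_subst[of semidecidable]) (auto simp: bind_eq_Some_conv)
next
  case (comp f g)
  note fg = comp.IH[THEN semidecidable_comp2]
  have "semidecidable (\<lambda>m. \<exists>u. g (pfst m) = Some u \<and> f u = Some (psnd m))"
    by (intro computability fg)
  then show ?case by (rule back_subst[of semidecidable]) (auto simp: bind_eq_Some_conv)
next
  case (prec f g)
  note fg = prec.IH[THEN semidecidable_comp2]
  let ?r = "\<lambda>a. rec_nat (f a) (\<lambda>i acc. Option.bind acc (\<lambda>v. g (prod_encode (a, prod_encode (i, v)))))"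
  have r: "?r a k = Some y \<longleftrightarrow> (\<exists>w. f a = Some (nth_code w 0)
      \<and> (\<forall>i<k. g (prod_encode (a, prod_encode (i, nth_code w i))) = Some (nth_code w (Suc i)))
      \<and> nth_code w k = y)" (is "_ \<longleftrightarrow> (\<exists>w. ?C w y k)") for a k y
  proof
    assume k: "?r a k = Some y"
    \<comment> \<open>Definedness propagates downwards from \<open>k\<close>, since an undefined
      stage makes all later stages undefined. Hence a full history exists.\<close>
    have def: "?r a i \<noteq> None" if "i \<le> k" for i
      using that
    proof (induction rule: inc_induct)
      case (step i)
      then show ?case by (auto simp: bind_eq_Some_conv)
    qed (simp add: k)
    obtain w where w: "\<forall>i<Suc k. nth_code w i = the (?r a i)"
      using nth_code_exists[of "Suc k" "\<lambda>i. the (?r a i)"] by (elim exE)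
    then have w': "?r a i = Some (nth_code w i)" if "i \<le> k" for i
      using option.collapse[OF def[OF that]] w that by (metis le_imp_less_Suc)
    have "g (prod_encode (a, prod_encode (i, nth_code w i))) = Some (nth_code w (Suc i))"
      if "i < k" for i
    proof -
      have "Option.bind (?r a i) (\<lambda>v. g (prod_encode (a, prod_encode (i, v)))) = ?r a (Suc i)"
        by simp
      then show ?thesis unfolding w'[OF Suc_leI[OF that]] w'[OF less_imp_le[OF that]] by simp
    qed
    moreover have "f a = Some (nth_code w 0)" using w'[of 0] by simp
    moreover have "nth_code w k = y" using w'[OF order_refl] k by simp
    ultimately show "\<exists>w. ?C w y k" by blast
  next
    assume "\<exists>w. ?C w y k"
    then obtain w where w: "?C w y k" by blast
    have "?r a i = Some (nth_code w i)" if "i \<le> k" for i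
      using that by (induction i) (simp_all add: w)
    from this[OF order_refl] w show "?r a k = Some y" by simp
  qed
  have "semidecidable (\<lambda>m. \<exists>w. f (pfst (pfst m)) = Some (nth_code w 0)
      \<and> (\<forall>i<psnd (pfst m). g (prod_encode (pfst (pfst m), prod_encode (i, nth_code w i)))
          = Some (nth_code w (Suc i)))
      \<and> nth_code w (psnd (pfst m)) = psnd m)"
    by (intro computability fg)
  then show ?case by (simp add: case_prod_beta r)
next
  case (mu f)
  note f = semidecidable_comp2[OF mu.IH]
  \<comment> \<open>The search demands only defined values before \<open>n\<close>; minimality of
    \<open>n\<close> makes them nonzero, hence successors.\<close>
  have eq: "mu_search f a = Some n \<longleftrightarrow> f (prod_encode (a, n)) = Some 0
      \<and> (\<forall>i<n. \<exists>v. f (prod_encode (a, i)) = Some (Suc v))" for a n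
  proof
    let ?D = "\<lambda>n. f (prod_encode (a, n)) = Some 0"
    assume "mu_search f a = Some n"
    then obtain k where k: "?D k" "\<forall>m<k. f (prod_encode (a, m)) \<noteq> None" and n: "n = (LEAST n. ?D n)"
      unfolding mu_search_def by (auto split: if_splits)
    have "?D n" "n \<le> k" unfolding n using k(1) by (auto intro: LeastI Least_le)
    moreover have "\<exists>v. f (prod_encode (a, i)) = Some (Suc v)" if "i < n" for i
      using k(2) \<open>n \<le> k\<close> that not_less_Least[of i ?D] unfolding n[symmetric]
      by (metis not0_implies_Suc not_None_eq order_less_le_trans)
    ultimately show "?D n \<and> (\<forall>i<n. \<exists>v. f (prod_encode (a, i)) = Some (Suc v))" by blast
  next
    assume *: "f (prod_encode (a, n)) = Some 0 \<and> (\<forall>i<n. \<exists>v. f (prod_encode (a, i)) = Some (Suc v))"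
    then have "(LEAST n. f (prod_encode (a, n)) = Some 0) = n"
      by (intro Least_equality) (auto simp: not_less[symmetric])
    moreover have "\<forall>m<n. f (prod_encode (a, m)) \<noteq> None" using * by force
    ultimately show "mu_search f a = Some n" using * unfolding mu_search_def by auto
  qed
  show ?case unfolding eq by (intro computability f)
qed

text \<open>Forward, a domain is a projected graph; backward, the unbounded search for a witness
  halts exactly on the set.\<close>

lemma ce_iff_semidecidable: "ce A \<longleftrightarrow> semidecidable (\<lambda>n. n \<in> A)"
proof
  assume "ce A"
  then obtain f where f: "partial_recursive f" "A = dom f" unfolding ce_def by blast
  have "semidecidable (\<lambda>n. \<exists>v. f n = Some v)"
    by (intro semidecidable_ex semidecidable_graph f)
  then show "semidecidable (\<lambda>n. n \<in> A)" by (simp add: f(2) dom_def)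
next
  assume "semidecidable (\<lambda>n. n \<in> A)"
  then obtain Q where Q: "decidable (\<lambda>m. Q (pfst m) (psnd m))" "\<And>n. n \<in> A \<longleftrightarrow> (\<exists>w. Q n w)"
    unfolding semidecidable_def by blast
  from mu[OF Q(1)[unfolded decidable_def recursive_def]] show "ce A"
    unfolding ce_def by (intro exI conjI) (auto simp: mu_search_def Q(2) split: if_splits)
qed

text \<open>Uniformisation: search for a code of a value together with its witness and return the
  value. The matrix is total, so the search fails only if no value exists.\<close>

lemma semidecidable_selection:
  assumes "semidecidable (\<lambda>m. H (pfst m) (psnd m))"
  obtains f where "partial_recursive f" "\<And>s. f s = None \<longleftrightarrow> (\<nexists>t. H s t)"
    "\<And>s t. f s = Some t \<Longrightarrow> H s t"
proof -
  obtain Q where Q: "decidable (\<lambda>m. Q (pfst m) (psnd m))"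
    "\<And>m. H (pfst m) (psnd m) \<longleftrightarrow> (\<exists>w. Q m w)"
    using assms unfolding semidecidable_def by blast
  have H: "H s t \<longleftrightarrow> (\<exists>w. Q (prod_encode (s, t)) w)" for s t
    using Q(2)[of "prod_encode (s, t)"] by simp
  define T where "T = (\<lambda>m. if Q (prod_encode (pfst m, pfst (psnd m))) (psnd (psnd m)) then 0 else 1 :: nat)"
  have "decidable (\<lambda>m. Q (prod_encode (pfst m, pfst (psnd m))) (psnd (psnd m)))"
    by (intro decidable_comp2[OF Q(1)] computability)
  then have "partial_recursive (\<lambda>m. Some (T m))"
    unfolding T_def decidable_def recursive_def .
  from comp[OF left mu[OF this]]
  have "partial_recursive (\<lambda>n. Option.bind (mu_search (\<lambda>m. Some (T m)) n) (\<lambda>n. Some (pfst n)))" .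
  moreover have ex: "(\<exists>n. T (prod_encode (s, n)) = 0) \<longleftrightarrow> (\<exists>t. H s t)" for s
    unfolding T_def H by simp (metis fst_conv prod_encode_inverse snd_conv)
  have "Option.bind (mu_search (\<lambda>m. Some (T m)) s) (\<lambda>n. Some (pfst n)) = None \<longleftrightarrow> (\<nexists>t. H s t)" for s
    unfolding ex[symmetric] by (auto simp: mu_search_def)
  moreover have "H s t" if "Option.bind (mu_search (\<lambda>m. Some (T m)) s) (\<lambda>n. Some (pfst n)) = Some t" for s t
  proof -
    have *: "\<exists>n. T (prod_encode (s, n)) = 0" "t = pfst (LEAST n. T (prod_encode (s, n)) = 0)"
      using that by (auto simp: mu_search_def split: if_splits)
    from LeastI_ex[OF *(1)] show ?thesis unfolding *(2) T_def H by (auto split: if_splits)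
  qed
  ultimately show thesis by (rule that)
qed

subsection \<open>Binary strings and expansions\<close>

text \<open>The first bit is the most significant, opposite to \<open>str_code\<close>: a string of
  length \<open>n\<close> thus denotes the dyadic interval of width \<open>1 / 2 ^ n\<close> whose
  left end has numerator \<open>str_val\<close>.\<close>

definition str_val :: "bool list \<Rightarrow> nat" where
  "str_val \<sigma> = foldl (\<lambda>a b. 2 * a + of_bool b) 0 \<sigma>"

lemma str_val_Nil [simp]: "str_val [] = 0"
  by (simp add: str_val_def)

lemma str_val_snoc [simp]: "str_val (\<sigma> @ [b]) = 2 * str_val \<sigma> + of_bool b"
  by (simp add: str_val_def)

lemma str_val_inject:
  "length \<sigma> = length \<tau> \<Longrightarrow> str_val \<sigma> = str_val \<tau> \<Longrightarrow> \<sigma> = \<tau>"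
proof (induction \<sigma> arbitrary: \<tau> rule: rev_induct)
  case (snoc b \<sigma>)
  obtain b' \<tau>' where \<tau>: "\<tau> = \<tau>' @ [b']" "length \<sigma> = length \<tau>'"
    using snoc.prems(1) by (cases \<tau> rule: rev_cases) auto
  have eq: "2 * str_val \<sigma> + of_bool b = 2 * str_val \<tau>' + of_bool b'"
    using snoc.prems(2) \<tau>(1) by simp
  then have "b = b'" by (cases b; cases b'; simp; presburger)
  with eq snoc.IH[OF \<tau>(2)] \<tau>(1) show ?case by simp
qed simp

text \<open>Links the codes on which machines act with the pairs of value and length that name
  intervals.\<close>

definition is_string :: "nat \<Rightarrow> nat \<Rightarrow> nat \<Rightarrow> bool" where
  "is_string s a n \<longleftrightarrow> (\<exists>\<sigma>. s = str_code \<sigma> \<and> a = str_val \<sigma> \<and> n = length \<sigma>)"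

lemma is_string_code: "is_string (str_code \<sigma>) a n \<longleftrightarrow> a = str_val \<sigma> \<and> n = length \<sigma>"
  using bij_str_code by (auto simp: is_string_def dest: injD[OF bij_is_inj])

text \<open>A string is read from its code by shifting out the bits one by one.\<close>

lemma semidecidable_is_string [computability]:
  assumes "recursive f" "recursive g" "recursive h"
  shows "semidecidable (\<lambda>m. is_string (f m) (g m) (h m))"
proof -
  \<comment> \<open>A state holds the unread code, the value read so far and the number of bits
    read. The old code is expressed through the new one, which avoids division; digit 1 is a
    \<open>False\<close>, digit 2 a \<open>True\<close>.\<close>
  define step where "step = (\<lambda>p q. psnd (psnd q) = Suc (psnd (psnd p))
    \<and> (pfst p = 2 * pfst q + 1 \<and> pfst (psnd q) = 2 * pfst (psnd p)
      \<or> pfst p = 2 * pfst q + 2 \<and> pfst (psnd q) = 2 * pfst (psnd p) + 1))"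
  define st where "st = (\<lambda>s a n. prod_encode (s, prod_encode (a, n)))"
  have st: "\<exists>s a n. p = st s a n" for p
    unfolding st_def by (metis prod.collapse prod_decode_inverse)
  have step_Cons: "step (st (str_code (b # \<sigma>)) a n) p
      \<longleftrightarrow> p = st (str_code \<sigma>) (2 * a + of_bool b) (Suc n)" for b \<sigma> a n p
  proof -
    obtain s' a' n' where p: "p = st s' a' n'" using st by blast
    show ?thesis
      unfolding p by (cases b) (auto simp: step_def st_def; presburger)+
  qed
  have run: "step\<^sup>*\<^sup>* (st (str_code \<sigma>) a0 l) (st 0 a n)
      \<longleftrightarrow> a = foldl (\<lambda>a b. 2 * a + of_bool b) a0 \<sigma> \<and> n = l + length \<sigma>" for \<sigma> a0 l a n
  proof (induction \<sigma> arbitrary: a0 l)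
    case Nil
    \<comment> \<open>The code 0 is neither \<open>2 * x + 1\<close> nor \<open>2 * x + 2\<close>,
      so reading stops there.\<close>
    have "\<not> step (st 0 a0 l) p" for p
      by (auto simp: step_def st_def)
    then have "step\<^sup>*\<^sup>* (st 0 a0 l) (st 0 a n) \<longleftrightarrow> st 0 a0 l = st 0 a n"
      by (metis converse_rtranclpE rtranclp.rtrancl_refl)
    then show ?case by (auto simp: st_def)
  next
    case (Cons b \<sigma>)
    have "st (str_code (b # \<sigma>)) a0 l \<noteq> st 0 a n" by (auto simp: st_def)
    then have "step\<^sup>*\<^sup>* (st (str_code (b # \<sigma>)) a0 l) (st 0 a n)
        \<longleftrightarrow> step\<^sup>*\<^sup>* (st (str_code \<sigma>) (2 * a0 + of_bool b) (Suc l)) (st 0 a n)"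
      by (metis converse_rtranclpE converse_rtranclp_into_rtranclp step_Cons)
    then show ?case using Cons.IH by simp
  qed
  have *: "is_string s a n \<longleftrightarrow> step\<^sup>*\<^sup>* (st s 0 0) (st 0 a n)" for s a n
  proof -
    obtain \<sigma> where s: "s = str_code \<sigma>" using bij_str_code by (meson bij_pointE)
    show ?thesis unfolding s is_string_code run str_val_def by simp
  qed
  show ?thesis
    unfolding * by (intro semidecidable_rtrancl; unfold st_def step_def; intro computability assms)
qed

abbreviation initial :: "(nat \<Rightarrow> bool) \<Rightarrow> nat \<Rightarrow> bool list" where
  "initial x n \<equiv> map x [0..<n]"

lemma str_val_initial_Suc:
  "str_val (initial x (Suc n)) = 2 * str_val (initial x n) + of_bool (x n)"
  by simp

lemma str_val_initial: "real (str_val (initial x n)) / 2 ^ n = (\<Sum>i<n. of_bool (x i) / 2 ^ (i + 1))"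
proof (induction n)
  case (Suc n)
  have "real (str_val (initial x (Suc n))) / 2 ^ Suc n
      = real (str_val (initial x n)) / 2 ^ n + of_bool (x n) / 2 ^ (n + 1)"
    unfolding str_val_initial_Suc by (simp add: field_simps)
  with Suc show ?case by simp
qed simp

text \<open>The tail of the series lies between 0 and a geometric series of sum
  \<open>1 / 2 ^ n\<close>. Both bounds can be attained, by tails of zeros or of ones.\<close>

lemma real_of_seq_bounds:
  "real (str_val (initial x n)) / 2 ^ n \<le> real_of_seq x"
  "real_of_seq x \<le> (real (str_val (initial x n)) + 1) / 2 ^ n"
proof -
  let ?f = "\<lambda>i. of_bool (x i) / 2 ^ (i + 1) :: real"
  have geo: "(\<lambda>i. (1/2) ^ (i + 1) * (1/2) ^ n :: real) sums ((1/2) ^ n)" for n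
    using sums_mult2[OF power_half_series, of "(1/2) ^ n"] by (simp add: mult.commute)
  have le: "?f i \<le> (1/2) ^ (i + 1)" for i by (simp add: power_divide)
  have sm: "summable ?f"
    by (rule summable_comparison_test'[OF sums_summable[OF geo[of 0]], of 0])
      (use le in auto)
  then have V: "real_of_seq x = (\<Sum>i. ?f (i + n)) + (\<Sum>i<n. ?f i)"
    unfolding real_of_seq_def by (rule suminf_split_initial_segment)
  have sm': "summable (\<lambda>i. ?f (i + n))" using summable_ignore_initial_segment[OF sm] .
  have "0 \<le> (\<Sum>i. ?f (i + n))" by (rule suminf_nonneg[OF sm']) simp
  then show "real (str_val (initial x n)) / 2 ^ n \<le> real_of_seq x"
    unfolding V str_val_initial by simp
  have "(\<Sum>i. ?f (i + n)) \<le> (\<Sum>i. (1/2) ^ (i + 1) * (1/2) ^ n)"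
    using le by (intro suminf_le sm' sums_summable[OF geo]) (simp add: power_add[symmetric] add_ac)
  also have "\<dots> = (1/2) ^ n" using geo by (simp only: sums_iff)
  finally show "real_of_seq x \<le> (real (str_val (initial x n)) + 1) / 2 ^ n"
    unfolding V add_divide_distrib str_val_initial by (simp add: power_divide)
qed

lemma real_of_seq_nonneg: "0 \<le> real_of_seq x" and real_of_seq_le_1: "real_of_seq x \<le> 1"
  using real_of_seq_bounds[of x 0] by simp_all

text \<open>The bits are the parities of the numerators. The resulting real and \<open>t\<close>
  share an interval of width \<open>1 / 2 ^ n\<close> for every \<open>n\<close>, hence are
  equal.\<close>

lemma expansion_exists:
  fixes a :: "nat \<Rightarrow> nat"
  assumes "a 0 = 0" "\<And>n. a (Suc n) div 2 = a n"
    and bounds: "\<And>n. real (a n) / 2 ^ n \<le> t" "\<And>n. t \<le> (real (a n) + 1) / 2 ^ n"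
  obtains x where "real_of_seq x = t" "\<And>n. str_val (initial x n) = a n"
proof -
  define x where "x = (\<lambda>n. odd (a (Suc n)))"
  have x: "str_val (initial x n) = a n" for n
  proof (induction n)
    case (Suc n)
    then show ?case
      unfolding str_val_initial_Suc x_def assms(2)[of n, symmetric] by (simp add: mod2_eq_if[symmetric])
  qed (simp add: assms(1))
  have "\<bar>real_of_seq x - t\<bar> \<le> (1/2) ^ n" for n
  proof -
    have "(1/2) ^ n = (real (a n) + 1) / 2 ^ n - real (a n) / 2 ^ n"
      by (simp add: field_simps power_divide)
    with bounds[of n] real_of_seq_bounds[of x n] show ?thesis unfolding x by linarith
  qed
  moreover have "(\<lambda>n. (1/2) ^ n :: real) \<longlonglongrightarrow> 0" by (intro LIMSEQ_power_zero) simp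
  ultimately have "\<bar>real_of_seq x - t\<bar> \<le> 0"
    by (intro LIMSEQ_le_const) auto
  with that x show thesis by simp
qed

text \<open>Rounding down leaves room to the right of \<open>t\<close> at every level; for dyadic
  \<open>t\<close> this is the expansion ending in zeros.\<close>

lemma right_expansion_exists:
  assumes "0 \<le> t" "t < 1"
  obtains x where "real_of_seq x = t" "\<And>n. real (str_val (initial x n)) / 2 ^ n \<le> t"
    "\<And>n. t < (real (str_val (initial x n)) + 1) / 2 ^ n"
proof -
  define a where "a = (\<lambda>n. nat \<lfloor>t * 2 ^ n\<rfloor>)"
  have a: "real (a n) \<le> t * 2 ^ n" "t * 2 ^ n < real (a n) + 1" for n
    using assms(1) by (simp_all add: a_def)
  have "a 0 = 0" using assms by (simp add: a_def floor_eq_iff)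
  moreover have "a (Suc n) div 2 = a n" for n
  proof -
    have "real (a (Suc n)) < 2 * real (a n) + 2" "2 * real (a n) < real (a (Suc n)) + 1"
      using a[of n] a[of "Suc n"] by (simp_all add: algebra_simps)
    then have "a (Suc n) < 2 * a n + 2" "2 * a n < a (Suc n) + 1" by linarith+
    then show ?thesis by linarith
  qed
  moreover have a': "real (a n) / 2 ^ n \<le> t" "t < (real (a n) + 1) / 2 ^ n" for n
    using a[of n] by (simp_all add: field_simps)
  ultimately obtain x where "real_of_seq x = t" "\<And>n. str_val (initial x n) = a n"
    using expansion_exists[of a t] by (metis less_imp_le)
  with that a' show thesis by simp
qed

text \<open>Rounding up and subtracting 1 leaves room to the left of \<open>t\<close>; for dyadic
  \<open>t\<close> this is the expansion ending in ones.\<close>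

lemma left_expansion_exists:
  assumes "0 < t" "t \<le> 1"
  obtains x where "real_of_seq x = t" "\<And>n. real (str_val (initial x n)) / 2 ^ n < t"
    "\<And>n. t \<le> (real (str_val (initial x n)) + 1) / 2 ^ n"
proof -
  define a where "a = (\<lambda>n. nat (\<lceil>t * 2 ^ n\<rceil> - 1))"
  have a: "real (a n) < t * 2 ^ n" "t * 2 ^ n \<le> real (a n) + 1" for n
  proof -
    have "0 < \<lceil>t * 2 ^ n\<rceil>" using assms(1) by simp
    then have "real (a n) = \<lceil>t * 2 ^ n\<rceil> - 1" unfolding a_def by simp
    then show "real (a n) < t * 2 ^ n" "t * 2 ^ n \<le> real (a n) + 1" by linarith+
  qed
  have "a 0 = 0" using a(1)[of 0] assms by simp
  moreover have "a (Suc n) div 2 = a n" for n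
  proof -
    have "real (a (Suc n)) < 2 * real (a n) + 2" "2 * real (a n) < real (a (Suc n)) + 1"
      using a[of n] a[of "Suc n"] by (simp_all add: algebra_simps)
    then have "a (Suc n) < 2 * a n + 2" "2 * a n < a (Suc n) + 1" by linarith+
    then show ?thesis by linarith
  qed
  moreover have a': "real (a n) / 2 ^ n < t" "t \<le> (real (a n) + 1) / 2 ^ n" for n
    using a[of n] by (simp_all add: field_simps)
  ultimately obtain x where "real_of_seq x = t" "\<And>n. str_val (initial x n) = a n"
    using expansion_exists[of a t] by (metis less_imp_le)
  with that a' show thesis by simp
qed

subsection \<open>Computable reals are not random\<close>

lemma dyadic_of_encode [simp]: "dyadic_of (prod_encode (a, n)) = real a / 2 ^ n"
  by (simp add: dyadic_of_def)

lemma dyadic_of_le_iff: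
  "dyadic_of p \<le> dyadic_of q \<longleftrightarrow> pfst p * 2 ^ psnd q \<le> pfst q * 2 ^ psnd p"
proof -
  have "dyadic_of p \<le> dyadic_of q
      \<longleftrightarrow> real (pfst p * 2 ^ psnd q) \<le> real (pfst q * 2 ^ psnd p)"
    by (simp add: dyadic_of_def case_prod_beta field_simps)
  then show ?thesis by (simp only: of_nat_le_iff)
qed

lemma decidable_dyadic_le [computability]:
  "recursive f \<Longrightarrow> recursive g \<Longrightarrow> decidable (\<lambda>n. dyadic_of (f n) \<le> dyadic_of (g n))"
  unfolding dyadic_of_le_iff by (intro computability)

lemma decidable_dyadic_less [computability]:
  "recursive f \<Longrightarrow> recursive g \<Longrightarrow> decidable (\<lambda>n. dyadic_of (f n) < dyadic_of (g n))"
  unfolding not_le[symmetric] dyadic_of_le_iff unfolding not_le by (intro computability)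

lemma dyadic_of_mem_dyadics: "dyadic_of n \<in> dyadics \<longleftrightarrow> dyadic_of n \<le> 1"
  by (auto simp: dyadics_def dyadic_of_def split: prod.split)

text \<open>Stated for value and length, the data naming a dyadic interval. Asking for one short
  description keeps it semidecidable, although \<open>K\<close> is not computable.\<close>

definition compressible :: "(bool list \<Rightarrow> bool list option) \<Rightarrow> nat \<Rightarrow> nat \<Rightarrow> nat \<Rightarrow> bool" where
  "compressible U c a n \<longleftrightarrow> (\<exists>\<sigma> \<tau>. a = str_val \<sigma> \<and> n = length \<sigma> \<and> U \<tau> = Some \<sigma> \<and> length \<tau> + c < n)"

lemma K_less_iff: "K U \<sigma> + enat c < enat n \<longleftrightarrow> (\<exists>\<tau>. U \<tau> = Some \<sigma> \<and> length \<tau> + c < n)"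
proof -
  have "K U \<sigma> + enat c < enat n \<longleftrightarrow> K U \<sigma> < enat (n - c)"
    by (cases "K U \<sigma>") (auto simp: less_diff_conv)
  also have "\<dots> \<longleftrightarrow> (\<exists>\<tau>. U \<tau> = Some \<sigma> \<and> length \<tau> < n - c)"
    unfolding K_def INF_less_iff by auto
  finally show ?thesis by (simp add: less_diff_conv)
qed

lemma not_randomness_constant_iff:
  "\<not> randomness_constant U x c \<longleftrightarrow> (\<exists>n. compressible U c (str_val (initial x n)) n)"
proof -
  have "compressible U c (str_val (initial x n)) n \<longleftrightarrow> K U (initial x n) + enat c < enat n" for n
    unfolding K_less_iff compressible_def by (metis diff_zero length_map length_upt str_val_inject)
  then show ?thesis by (simp add: randomness_constant_def not_le)
qed

lemma semidecidable_compressible: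
  assumes "prefix_free_machine U" "recursive a" "recursive n"
  shows "semidecidable (\<lambda>m. compressible U c (a m) (n m))"
proof -
  obtain f where f: "partial_recursive f" "\<And>\<sigma>. f (str_code \<sigma>) = map_option str_code (U \<sigma>)"
    using assms(1) unfolding prefix_free_machine_def computable_str_def by blast
  have "compressible U c a n \<longleftrightarrow>
      (\<exists>s t y l. f s = Some t \<and> is_string s y l \<and> is_string t a n \<and> l + c < n)" for a n
  proof
    assume "compressible U c a n"
    then obtain \<sigma> \<tau> where "a = str_val \<sigma>" "n = length \<sigma>" "U \<tau> = Some \<sigma>" "length \<tau> + c < n"
      unfolding compressible_def by blast
    then show "\<exists>s t y l. f s = Some t \<and> is_string s y l \<and> is_string t a n \<and> l + c < n"
      by (intro exI[of _ "str_code \<tau>"] exI[of _ "str_code \<sigma>"] exI[of _ "str_val \<tau>"]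
          exI[of _ "length \<tau>"]) (simp add: f(2) is_string_code)
  next
    assume "\<exists>s t y l. f s = Some t \<and> is_string s y l \<and> is_string t a n \<and> l + c < n"
    then obtain \<sigma> \<tau> where *: "f (str_code \<tau>) = Some (str_code \<sigma>)"
      "a = str_val \<sigma>" "n = length \<sigma>" "length \<tau> + c < n"
      unfolding is_string_def by blast
    then have "U \<tau> = Some \<sigma>"
      using bij_str_code by (auto simp: f(2) dest: injD[OF bij_is_inj])
    with * show "compressible U c a n" unfolding compressible_def by blast
  qed
  then show ?thesis
    by (simp only:) (intro computability semidecidable_comp2[OF semidecidable_graph[OF f(1)]]
        recursive_comp[OF assms(2)] recursive_comp[OF assms(3)])
qed

text \<open>Prepending \<open>True\<close> sends a code \<open>s\<close> to
  \<open>2 * s + 2\<close>, which doubles \<open>s + 2\<close>. The descriptions used below are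
  therefore recognisable by arithmetic.\<close>

lemma str_code_unary: "str_code (replicate k True @ [False]) + 2 = 3 * 2 ^ k"
  by (induction k) auto

text \<open>The machine mapping \<open>1\<^sup>k0\<close> to the first \<open>2k\<close> bits of \<open>x\<close> compresses prefixes of \<open>x\<close> to
  about half their length.\<close>

lemma computable_not_random:
  assumes U: "universal_prefix_free U"
    and G: "semidecidable (\<lambda>m. G (pfst m) (psnd m))"
    and sound: "\<And>a n. G a n \<Longrightarrow> a = str_val (initial x n)"
    and complete: "\<And>n. N \<le> n \<Longrightarrow> G (str_val (initial x n)) n"
  shows "\<not> randomness_constant U x c"
proof
  assume rc: "randomness_constant U x c"
  \<comment> \<open>The equation on \<open>s\<close> says that \<open>s\<close> codes the
    description with \<open>k\<close> ones; \<open>t\<close> then codes a string of length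
    \<open>2 * k\<close> accepted by \<open>G\<close>.\<close>
  define H where "H = (\<lambda>(s::nat) (t::nat). \<exists>k a. s + 2 = 3 * 2 ^ k \<and> is_string t a (2 * k) \<and> G a (2 * k))"
  have "semidecidable (\<lambda>m. H (pfst m) (psnd m))"
    unfolding H_def by (intro computability semidecidable_comp2[OF G])
  then obtain f where f: "partial_recursive f" "\<And>s. f s = None \<longleftrightarrow> (\<nexists>t. H s t)"
    "\<And>s t. f s = Some t \<Longrightarrow> H s t"
    by (rule semidecidable_selection) blast
  define M where "M = (\<lambda>\<tau>. map_option (inv str_code) (f (str_code \<tau>)))"
  have inj: "inj str_code" and surj: "surj str_code"
    using bij_str_code by (simp_all add: bij_is_inj bij_is_surj)
  have "map_option str_code (M \<tau>) = f (str_code \<tau>)" for \<tau>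
    by (simp add: M_def option.map_comp o_def surj_f_inv_f[OF surj] option.map_ident)
  then have "computable_str M" unfolding computable_str_def using f(1) by metis
  moreover have dom: "\<exists>k. \<tau> = replicate k True @ [False]" if "\<tau> \<in> dom M" for \<tau>
  proof -
    have "f (str_code \<tau>) \<noteq> None" using that by (auto simp: M_def)
    then obtain t where "H (str_code \<tau>) t" using f(2)[of "str_code \<tau>"] by auto
    then obtain k where "str_code \<tau> + 2 = str_code (replicate k True @ [False]) + 2"
      unfolding H_def str_code_unary by blast
    then show ?thesis by (auto dest: injD[OF inj])
  qed
  have "\<sigma> = \<tau>" if mem: "\<sigma> \<in> dom M" "\<tau> \<in> dom M" and "prefix \<sigma> \<tau>" for \<sigma> \<tau>
  proof -
    obtain j k where jk: "\<sigma> = replicate j True @ [False]" "\<tau> = replicate k True @ [False]"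
      using dom[OF mem(1)] dom[OF mem(2)] by blast
    obtain \<rho> where \<rho>: "\<tau> = \<sigma> @ \<rho>" using \<open>prefix \<sigma> \<tau>\<close> by (auto simp: prefix_def)
    \<comment> \<open>Position \<open>j\<close> holds the final \<open>False\<close> of the shorter
      description, and a description has only one \<open>False\<close>.\<close>
    have "\<tau> ! j = False" unfolding \<rho> jk(1) by (simp add: nth_append)
    moreover have "j \<le> k" using arg_cong[OF \<rho>, of length] by (simp add: jk)
    ultimately have "j = k" unfolding jk(2) by (auto simp: nth_append split: if_splits)
    with jk show ?thesis by simp
  qed
  ultimately have "prefix_free_machine M" unfolding prefix_free_machine_def by blast
  with U obtain d where d: "\<And>\<sigma>. K U \<sigma> \<le> K M \<sigma> + enat d"
    unfolding universal_prefix_free_def by blast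
  \<comment> \<open>The choice ensures \<open>N \<le> 2 * k\<close> and also
    \<open>(k + 1) + d + c < 2 * k\<close>, where \<open>k + 1\<close> is the length of the
    description.\<close>
  define k where "k = N + d + c + 2"
  let ?\<tau> = "replicate k True @ [False]"
  have "\<exists>t. H (str_code ?\<tau>) t"
    unfolding H_def
    using complete[of "2 * k"] is_string_code[of "initial x (2 * k)"] str_code_unary[of k]
    by (intro exI[of _ "str_code (initial x (2 * k))"] exI[of _ k]
        exI[of _ "str_val (initial x (2 * k))"]) (simp add: k_def)
  then obtain t where t: "f (str_code ?\<tau>) = Some t" using f(2) by (metis not_None_eq)
  from f(3)[OF t] obtain k' a where a: "3 * 2 ^ k = (3 * 2 ^ k' :: nat)" "is_string t a (2 * k')" "G a (2 * k')"
    unfolding H_def str_code_unary by blast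
  then have "k' = k" by simp
  \<comment> \<open>The selection returns just some \<open>t\<close>, but soundness of
    \<open>G\<close> leaves only one candidate.\<close>
  then have "t = str_code (initial x (2 * k))"
    using a(2) sound[OF a(3)] unfolding is_string_def
    by (metis diff_zero length_map length_upt str_val_inject)
  then have "M ?\<tau> = Some (initial x (2 * k))" by (simp add: M_def t inv_f_f[OF inj])
  then have "K M (initial x (2 * k)) \<le> enat (length ?\<tau>)"
    unfolding K_def by (intro INF_lower) simp
  then have "K U (initial x (2 * k)) + enat c \<le> enat (length ?\<tau>) + enat d + enat c"
    using d[of "initial x (2 * k)"] by (meson add_right_mono order_trans)
  then have "K U (initial x (2 * k)) + enat c < enat (2 * k)"
    by (rule le_less_trans) (simp add: k_def)
  with rc show False by (simp add: randomness_constant_def leD)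
qed

lemma initial_interval_mono:
  assumes "m \<le> n"
  shows "real (str_val (initial x m)) / 2 ^ m \<le> real (str_val (initial x n)) / 2 ^ n"
    and "(real (str_val (initial x n)) + 1) / 2 ^ n \<le> (real (str_val (initial x m)) + 1) / 2 ^ m"
proof -
  have step: "real (str_val (initial x i)) / 2 ^ i \<le> real (str_val (initial x (Suc i))) / 2 ^ Suc i"
    "(real (str_val (initial x (Suc i))) + 1) / 2 ^ Suc i \<le> (real (str_val (initial x i)) + 1) / 2 ^ i"
    for i
    unfolding str_val_initial_Suc by (simp_all add: divide_simps)
  show "real (str_val (initial x m)) / 2 ^ m \<le> real (str_val (initial x n)) / 2 ^ n"
    using lift_Suc_mono_le[of "\<lambda>i. real (str_val (initial x i)) / 2 ^ i", OF step(1) assms] .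
  show "(real (str_val (initial x n)) + 1) / 2 ^ n \<le> (real (str_val (initial x m)) + 1) / 2 ^ m"
    using lift_Suc_antimono_le[of "\<lambda>i. (real (str_val (initial x i)) + 1) / 2 ^ i", OF step(2) assms] .
qed

text \<open>If the real is interior to its dyadic interval at every level, strict comparisons
  identify each interval. Otherwise it is an endpoint from some level \<open>n0\<close> on, hence a
  fixed dyadic rational, and comparison with that rational decides the numerators.\<close>

lemma computable_real_not_random:
  assumes U: "universal_prefix_free U"
    and below: "semidecidable (\<lambda>n. dyadic_of n < real_of_seq x)"
    and above: "semidecidable (\<lambda>n. real_of_seq x < dyadic_of n)"
  shows "\<not> randomness_constant U x c"
proof -
  let ?l = "\<lambda>n. real (str_val (initial x n)) / 2 ^ n"
  let ?u = "\<lambda>n. (real (str_val (initial x n)) + 1) / 2 ^ n"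
  consider (lower) n0 where "real_of_seq x = ?l n0" | (upper) n0 where "real_of_seq x = ?u n0"
    | (interior) "\<And>n. ?l n < real_of_seq x" "\<And>n. real_of_seq x < ?u n"
    using real_of_seq_bounds[of x] by (metis order_le_imp_less_or_eq)
  then show ?thesis
  proof cases
    case lower
    define p where "p = prod_encode (str_val (initial x n0), n0)"
    have p: "real_of_seq x = dyadic_of p" by (simp add: p_def lower)
    have eq: "?l n = dyadic_of p" if "n0 \<le> n" for n
      using initial_interval_mono(1)[OF that, of x] real_of_seq_bounds(1)[of x n] lower p by simp
    show ?thesis
    proof (rule computable_not_random[OF U, where N = n0 and G = "\<lambda>a n. n0 \<le> n
        \<and> dyadic_of (prod_encode (a, n)) \<le> dyadic_of p \<and> dyadic_of p \<le> dyadic_of (prod_encode (a, n))"],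
        goal_cases)
      case 1
      then show ?case
        by (intro semidecidable_decidable decidable_conj computability)
    next
      case (2 a n)
      then have "real a / 2 ^ n = ?l n" using eq[of n] by simp
      then show ?case by simp
    qed (simp add: eq)
  next
    case upper
    define p where "p = prod_encode (Suc (str_val (initial x n0)), n0)"
    have p: "real_of_seq x = dyadic_of p" by (simp add: p_def upper add.commute)
    have eq: "?u n = dyadic_of p" if "n0 \<le> n" for n
      using initial_interval_mono(2)[OF that, of x] real_of_seq_bounds(2)[of x n] upper p by simp
    show ?thesis
    proof (rule computable_not_random[OF U, where N = n0 and G = "\<lambda>a n. n0 \<le> n
        \<and> dyadic_of (prod_encode (Suc a, n)) \<le> dyadic_of p
        \<and> dyadic_of p \<le> dyadic_of (prod_encode (Suc a, n))"], goal_cases)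
      case 1
      then show ?case
        by (intro semidecidable_decidable decidable_conj computability)
    next
      case (2 a n)
      then have "(1 + real a) / 2 ^ n = ?u n" using eq[of n] by simp
      then show ?case by simp
    next
      case (3 n)
      then show ?case using eq[of n] by (simp add: add.commute)
    qed
  next
    case interior
    show ?thesis
    proof (rule computable_not_random[OF U, where N = 0 and G = "\<lambda>a n.
        dyadic_of (prod_encode (a, n)) < real_of_seq x
        \<and> real_of_seq x < dyadic_of (prod_encode (Suc a, n))"], goal_cases)
      case 1
      then show ?case
        by (intro computability semidecidable_comp[OF below] semidecidable_comp[OF above])
    next
      case (2 a n)
      \<comment> \<open>Two dyadic intervals of the same level with a common interior point
        coincide.\<close>
      with interior[of n] have "real a / 2 ^ n < ?u n" "?l n < (1 + real a) / 2 ^ n"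
        by (auto simp del: of_nat_Suc simp: of_nat_Suc)
      then have "real a < real (str_val (initial x n)) + 1" "real (str_val (initial x n)) < 1 + real a"
        by (simp_all add: divide_less_cancel)
      then show ?case by linarith
    next
      case (3 n)
      then show ?case
        using interior[of n] by (simp add: add.commute)
    qed
  qed
qed

text \<open>Both cuts of a dyadic real are decidable. From here on, interval endpoints may be
  disregarded when dealing with \<open>S\<close>.\<close>

lemma dyadic_not_random:
  assumes "universal_prefix_free U" "randomness_constant U x c"
  shows "real_of_seq x \<noteq> dyadic_of p"
proof
  assume "real_of_seq x = dyadic_of p"
  then show False
    using computable_real_not_random[OF assms(1), of x c] assms(2)
    by (simp add: computability)
qed

subsection \<open>Covers by compressible intervals\<close>

text \<open>A number coding \<open>(a, n)\<close> stands for the closed dyadic interval from \<open>a / 2 ^ n\<close> to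
  \<open>(a + 1) / 2 ^ n\<close>.\<close>

abbreviation right_end :: "nat \<Rightarrow> nat" where
  "right_end p \<equiv> prod_encode (Suc (pfst p), psnd p)"

definition bad :: "(bool list \<Rightarrow> bool list option) \<Rightarrow> nat \<Rightarrow> nat \<Rightarrow> bool" where
  "bad U c p \<longleftrightarrow> compressible U c (pfst p) (psnd p)"

text \<open>Only the left end of the next interval is constrained: intervals may overlap, touch or
  step back, but leave no gap.\<close>

definition chained :: "(bool list \<Rightarrow> bool list option) \<Rightarrow> nat \<Rightarrow> nat \<Rightarrow> nat \<Rightarrow> bool" where
  "chained U c p q \<longleftrightarrow> bad U c q \<and> dyadic_of q \<le> dyadic_of (right_end p)"

text \<open>A finite subcover in semidecidable form: a chain replaces a finite set of intervals, so
  that \<open>semidecidable_rtrancl\<close> applies.\<close>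

definition cover :: "(bool list \<Rightarrow> bool list option) \<Rightarrow> nat \<Rightarrow> real \<Rightarrow> real \<Rightarrow> bool" where
  "cover U c a b \<longleftrightarrow> (\<exists>p q. bad U c p \<and> dyadic_of p \<le> a \<and> (chained U c)\<^sup>*\<^sup>* p q
    \<and> b \<le> dyadic_of (right_end q))"

lemma semidecidable_cover:
  assumes "prefix_free_machine U" "recursive f" "recursive g"
  shows "semidecidable (\<lambda>n. cover U c (dyadic_of (f n)) (dyadic_of (g n)))"
proof -
  have bad: "semidecidable (\<lambda>n. bad U c (h n))" if "recursive h" for h
    unfolding bad_def by (intro semidecidable_compressible assms(1) recursive_pfst recursive_psnd that)
  have "semidecidable (\<lambda>m. chained U c (pfst m) (psnd m))"
    unfolding chained_def by (intro semidecidable_conj bad) (intro computability)+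
  note rtrancl = semidecidable_rtrancl[OF this]
  show ?thesis
    unfolding cover_def
    by (intro semidecidable_ex semidecidable_conj bad rtrancl)
      (intro computability recursive_comp[OF assms(2)] recursive_comp[OF assms(3)])+
qed

text \<open>The last interval of the first chain reaches \<open>b\<close>, where the second chain
  has already begun, so the chains can be joined.\<close>

lemma cover_trans:
  assumes "cover U c a b" "cover U c b d"
  shows "cover U c a d"
proof -
  obtain p q where pq: "bad U c p" "dyadic_of p \<le> a" "(chained U c)\<^sup>*\<^sup>* p q" "b \<le> dyadic_of (right_end q)"
    using assms(1) unfolding cover_def by blast
  obtain p' q' where pq': "bad U c p'" "dyadic_of p' \<le> b" "(chained U c)\<^sup>*\<^sup>* p' q'"
    "d \<le> dyadic_of (right_end q')"
    using assms(2) unfolding cover_def by blast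
  have "chained U c q p'" using pq(4) pq'(1,2) unfolding chained_def by (meson order_trans)
  with pq pq' show ?thesis unfolding cover_def
    by (meson converse_rtranclp_into_rtranclp rtranclp_trans)
qed

text \<open>Walk along the chain: while \<open>t\<close> lies beyond the current right end, it also
  lies to the right of the next left end.\<close>

lemma cover_imp_bad:
  assumes "cover U c a b" "a \<le> t" "t \<le> b"
  shows "\<exists>p. bad U c p \<and> dyadic_of p \<le> t \<and> t \<le> dyadic_of (right_end p)"
proof -
  obtain p q where pq: "bad U c p" "dyadic_of p \<le> a" "(chained U c)\<^sup>*\<^sup>* p q" "b \<le> dyadic_of (right_end q)"
    using assms(1) unfolding cover_def by blast
  have "t \<le> dyadic_of (right_end q)" "dyadic_of p \<le> t" using pq assms by linarith+
  with pq(3,1) show ?thesis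
  proof (induction rule: converse_rtranclp_induct)
    case (step p r)
    show ?case
    proof (cases "t \<le> dyadic_of (right_end p)")
      case False
      with step.hyps(1) show ?thesis
        by (intro step.IH step.prems) (auto simp: chained_def)
    qed (use step.prems in blast)
  qed blast
qed

definition random_reals :: "(bool list \<Rightarrow> bool list option) \<Rightarrow> nat \<Rightarrow> real set" where
  "random_reals U c = {real_of_seq x | x. randomness_constant U x c}"

lemma random_reals_I: "randomness_constant U x c \<Longrightarrow> real_of_seq x \<in> random_reals U c"
  by (auto simp: random_reals_def)

lemma random_reals_bounds: "t \<in> random_reals U c \<Longrightarrow> 0 \<le> t" "t \<in> random_reals U c \<Longrightarrow> t \<le> 1"
  using real_of_seq_nonneg real_of_seq_le_1 by (auto simp: random_reals_def)

text \<open>A member of \<open>S\<close> is not an endpoint, so a closed interval containing it is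
  the interval of one of its initial segments, which would then be compressible.\<close>

lemma bad_disjoint_random_reals:
  assumes U: "universal_prefix_free U" and "bad U c p" "dyadic_of p \<le> t" "t \<le> dyadic_of (right_end p)"
  shows "t \<notin> random_reals U c"
proof
  assume "t \<in> random_reals U c"
  then obtain x where rc: "randomness_constant U x c" and t: "t = real_of_seq x"
    by (auto simp: random_reals_def)
  let ?n = "psnd p"
  let ?s = "str_val (initial x ?n)"
  note ne = dyadic_not_random[OF U rc]
  have "pfst p = ?s"
  proof -
    have "dyadic_of p < t" "t < dyadic_of (right_end p)"
      using assms(3,4) ne[of p] ne[of "right_end p"] unfolding t by linarith+
    then have "real (pfst p) / 2 ^ ?n < (real ?s + 1) / 2 ^ ?n" "real ?s / 2 ^ ?n < (real (pfst p) + 1) / 2 ^ ?n"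
      using real_of_seq_bounds[of x ?n] unfolding t by (simp_all add: dyadic_of_def case_prod_beta add.commute)
    then show ?thesis by (simp add: divide_less_cancel)
  qed
  with assms(2) rc not_randomness_constant_iff[of U x c] show False
    unfolding bad_def by auto
qed

lemma cover_disjoint_random_reals:
  assumes "universal_prefix_free U" "cover U c a b" "a \<le> t" "t \<le> b"
  shows "t \<notin> random_reals U c"
  using cover_imp_bad[OF assms(2-4)] bad_disjoint_random_reals[OF assms(1)] by blast

text \<open>A dyadic real has two expansions, which provide the intervals on its two sides.\<close>

lemma cover_local:
  assumes t: "0 \<le> t" "t \<le> 1" "t \<notin> random_reals U c"
  obtains d where "d > 0"
    "\<And>a b. 0 \<le> a \<Longrightarrow> a \<le> t \<Longrightarrow> t \<le> b \<Longrightarrow> b \<le> 1 \<Longrightarrow> b - a < d \<Longrightarrow> cover U c a b"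
proof -
  have nonrandom: "\<exists>n. bad U c (prod_encode (str_val (initial x n), n))" if "real_of_seq x = t" for x
    using that t(3) not_randomness_constant_iff[of U x c] random_reals_I[of U x c]
    by (auto simp: bad_def)
  have coverI: "cover U c a b" if "bad U c p" "dyadic_of p \<le> a" "b \<le> dyadic_of (right_end p)" for a b p
    using that unfolding cover_def by blast
  have right: "\<exists>d>0. \<forall>b. b - t < d \<longrightarrow> cover U c t b" if t1: "t < 1"
  proof -
    obtain x where x: "real_of_seq x = t" "\<And>n. real (str_val (initial x n)) / 2 ^ n \<le> t"
      "\<And>n. t < (real (str_val (initial x n)) + 1) / 2 ^ n"
      using right_expansion_exists[OF t(1) t1] by blast
    obtain n where n: "bad U c (prod_encode (str_val (initial x n), n))" using nonrandom[OF x(1)] by blast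
    show ?thesis
      using x(2,3)[of n] by (intro exI[of _ "(real (str_val (initial x n)) + 1) / 2 ^ n - t"])
        (auto intro!: coverI[OF n] simp: add.commute)
  qed
  have left: "\<exists>d>0. \<forall>a. t - a < d \<longrightarrow> cover U c a t" if t0: "0 < t"
  proof -
    obtain x where x: "real_of_seq x = t" "\<And>n. real (str_val (initial x n)) / 2 ^ n < t"
      "\<And>n. t \<le> (real (str_val (initial x n)) + 1) / 2 ^ n"
      using left_expansion_exists[OF t0 t(2)] by blast
    obtain n where n: "bad U c (prod_encode (str_val (initial x n), n))" using nonrandom[OF x(1)] by blast
    show ?thesis
      using x(2,3)[of n] by (intro exI[of _ "t - real (str_val (initial x n)) / 2 ^ n"])
        (auto intro!: coverI[OF n] simp: add.commute)
  qed
  \<comment> \<open>At 0 or 1 one side suffices, as the bounds on \<open>a\<close> and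
    \<open>b\<close> force one of them to equal \<open>t\<close>; inside, two covers are glued at
    \<open>t\<close>.\<close>
  consider "t = 0" | "t = 1" | "0 < t" "t < 1" using t by linarith
  then show thesis
  proof cases
    case 1
    then obtain d where "d > 0" "\<forall>b. b - t < d \<longrightarrow> cover U c t b" using right by auto
    with 1 show thesis by (intro that[of d]) auto
  next
    case 2
    then obtain d where "d > 0" "\<forall>a. t - a < d \<longrightarrow> cover U c a t" using left by auto
    with 2 show thesis by (intro that[of d]) auto
  next
    case 3
    then obtain d e where "d > 0" "\<forall>a. t - a < d \<longrightarrow> cover U c a t" "e > 0" "\<forall>b. b - t < e \<longrightarrow> cover U c t b"
      using left right by metis
    then show thesis by (intro that[of "min d e"]) (auto intro: cover_trans[of U c _ t])
  qed
qed

text \<open>Compactness in the form of an interval induction: being covered is additive by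
  \<open>cover_trans\<close> and holds locally by \<open>cover_local\<close>.\<close>

lemma cover_complete:
  assumes "0 \<le> a" "a \<le> b" "b \<le> 1" "\<And>t. a \<le> t \<Longrightarrow> t \<le> b \<Longrightarrow> t \<notin> random_reals U c"
  shows "cover U c a b"
proof -
  \<comment> \<open>The guard is part of the induction predicate because the small intervals of the
    local step may stick out of the unit interval.\<close>
  have "0 \<le> a \<and> b \<le> 1 \<longrightarrow> cover U c a b"
    using \<open>a \<le> b\<close>
  proof (induction rule: Bolzano)
    case (trans a b d)
    then show ?case using cover_trans[of U c a b d] by auto
  next
    case (local t)
    then obtain d where "d > 0"
      "\<And>a b. 0 \<le> a \<Longrightarrow> a \<le> t \<Longrightarrow> t \<le> b \<Longrightarrow> b \<le> 1 \<Longrightarrow> b - a < d \<Longrightarrow> cover U c a b"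
      using cover_local[of t U c] assms by (metis order_trans)
    then show ?case by blast
  qed
  with assms show ?thesis by blast
qed

subsection \<open>Extremal random reals\<close>

text \<open>\<open>S\<close> is closed: a point outside \<open>S\<close> has a neighbourhood with
  covers, so members of \<open>S\<close> cannot approach it.\<close>

lemma Inf_random_reals_mem:
  assumes U: "universal_prefix_free U" and t: "t \<in> random_reals U c" "q \<le> t"
  defines "A \<equiv> {v \<in> random_reals U c. q \<le> v}"
  shows "Inf A \<in> A"
proof -
  have bdd: "bdd_below A" and ne: "A \<noteq> {}"
    using t by (auto simp: A_def intro: bdd_belowI[of _ q])
  have q: "q \<le> Inf A" using ne by (intro cInf_greatest) (auto simp: A_def)
  have pos: "0 \<le> Inf A" using ne random_reals_bounds by (intro cInf_greatest) (auto simp: A_def)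
  have le1: "Inf A \<le> 1" using cInf_lower[of t A] bdd t random_reals_bounds[of t U c] by (auto simp: A_def)
  have "Inf A \<in> random_reals U c"
  proof (rule ccontr)
    assume "Inf A \<notin> random_reals U c"
    then obtain d where d: "d > 0"
      "\<And>a b. 0 \<le> a \<Longrightarrow> a \<le> Inf A \<Longrightarrow> Inf A \<le> b \<Longrightarrow> b \<le> 1 \<Longrightarrow> b - a < d \<Longrightarrow> cover U c a b"
      using cover_local pos le1 by metis
    obtain v where v: "v \<in> A" "v < Inf A + d"
      using cInf_lessD[OF ne, of "Inf A + d"] d(1) by auto
    then have "Inf A \<le> v" "v \<in> random_reals U c" using bdd by (auto intro: cInf_lower simp: A_def)
    moreover from this have "cover U c (Inf A) v"
      using v d(2)[of "Inf A" v] pos random_reals_bounds(2) by simp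
    ultimately show False using cover_disjoint_random_reals[OF U, of c "Inf A" v v] by simp
  qed
  with q show ?thesis by (simp add: A_def)
qed

lemma Sup_random_reals_mem:
  assumes U: "universal_prefix_free U" and ne: "random_reals U c \<noteq> {}"
  shows "Sup (random_reals U c) \<in> random_reals U c" (is "Sup ?A \<in> ?A")
proof (rule ccontr)
  have bdd: "bdd_above ?A" using random_reals_bounds by (intro bdd_aboveI[of _ 1])
  have le1: "Sup ?A \<le> 1" using ne random_reals_bounds by (intro cSup_least)
  obtain t where "t \<in> ?A" using ne by blast
  then have pos: "0 \<le> Sup ?A"
    using cSup_upper[OF _ bdd, of t] random_reals_bounds(1)[of t U c] by simp
  assume "Sup ?A \<notin> ?A"
  then obtain d where d: "d > 0"
    "\<And>a b. 0 \<le> a \<Longrightarrow> a \<le> Sup ?A \<Longrightarrow> Sup ?A \<le> b \<Longrightarrow> b \<le> 1 \<Longrightarrow> b - a < d \<Longrightarrow> cover U c a b"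
    using cover_local pos le1 by metis
  obtain v where v: "v \<in> ?A" "Sup ?A - d < v"
    using less_cSupD[OF ne, of "Sup ?A - d"] d(1) by auto
  then have "v \<le> Sup ?A" using bdd by (auto intro: cSup_upper)
  moreover from this have "cover U c v (Sup ?A)"
    using v d(2)[of v "Sup ?A"] le1 random_reals_bounds(1) by simp
  ultimately show False using v cover_disjoint_random_reals[OF U, of c v "Sup ?A" v] by simp
qed

text \<open>Applied to the maximum of \<open>S\<close>, this yields left-c.e. members arbitrarily
  close to it.\<close>

lemma left_ce_random_above:
  assumes U: "universal_prefix_free U" and x: "randomness_constant U x c" "dyadic_of p \<le> real_of_seq x"
  obtains y where "left_ce y" "randomness_constant U y c" "dyadic_of p \<le> real_of_seq y"
proof -
  define u where "u = Inf {v \<in> random_reals U c. dyadic_of p \<le> v}"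
  have u: "u \<in> random_reals U c" "dyadic_of p \<le> u"
    using Inf_random_reals_mem[OF U random_reals_I[OF x(1)] x(2)] by (auto simp: u_def)
  then obtain y where y: "u = real_of_seq y" "randomness_constant U y c"
    by (auto simp: random_reals_def)
  have least: "u \<le> v" if "v \<in> random_reals U c" "dyadic_of p \<le> v" for v
    unfolding u_def using that by (intro cInf_lower bdd_belowI[of _ "dyadic_of p"]) auto
  \<comment> \<open>Between \<open>p\<close> and \<open>u\<close> there is nothing of
    \<open>S\<close>, so \<open>n\<close> beyond \<open>p\<close> is still below \<open>u\<close>
    iff the interval from \<open>p\<close> to \<open>n\<close> has a cover. Strictness at
    \<open>p\<close> holds as \<open>u\<close> is not dyadic.\<close>
  have below: "dyadic_of n < u \<longleftrightarrow> dyadic_of n \<le> dyadic_of p \<or> cover U c (dyadic_of p) (dyadic_of n)"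
    if "dyadic_of n \<le> 1" for n
  proof
    assume n: "dyadic_of n < u"
    show "dyadic_of n \<le> dyadic_of p \<or> cover U c (dyadic_of p) (dyadic_of n)"
    proof (rule disjCI)
      assume "\<not> cover U c (dyadic_of p) (dyadic_of n)"
      moreover have "0 \<le> dyadic_of p" by (simp add: dyadic_of_def case_prod_beta)
      ultimately show "dyadic_of n \<le> dyadic_of p"
        using cover_complete[of "dyadic_of p" "dyadic_of n" U c] that least n
        by (metis le_less_trans linear not_le)
    qed
  next
    assume "dyadic_of n \<le> dyadic_of p \<or> cover U c (dyadic_of p) (dyadic_of n)"
    then show "dyadic_of n < u"
    proof
      assume "dyadic_of n \<le> dyadic_of p"
      with u(2) dyadic_not_random[OF U y(2), of p] show ?thesis by (simp add: y(1))
    next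
      assume "cover U c (dyadic_of p) (dyadic_of n)"
      from cover_disjoint_random_reals[OF U this u(2)] u(1) show ?thesis by (meson not_le)
    qed
  qed
  \<comment> \<open>The pair \<open>(1, 0)\<close> names the rational 1, which brings the bound into
    the form of the decidability rules.\<close>
  have "semidecidable (\<lambda>n. dyadic_of n \<le> dyadic_of (prod_encode (1, 0))
      \<and> (dyadic_of n \<le> dyadic_of p \<or> cover U c (dyadic_of p) (dyadic_of n)))"
    using U[unfolded universal_prefix_free_def]
    by (intro semidecidable_cover computability) auto
  then have "left_ce y"
    unfolding left_ce_def ce_dyadic_def ce_iff_semidecidable
    by (rule back_subst[of semidecidable]) (auto simp: dyadic_of_mem_dyadics below y(1)[symmetric])
  with y u that show thesis by blast
qed

text \<open>Randomness constants are closed upwards, so the least one is at most \<open>c\<close>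
  iff \<open>c\<close> itself is one.\<close>

lemma random_left_ce_atLeastAtMost:
  "random_left_ce U {0..c} = {x. left_ce x \<and> randomness_constant U x c}"
proof -
  have mono: "randomness_constant U x c" if "randomness_constant U x k" "k \<le> c" for x k
    using that unfolding randomness_constant_def
    by (meson add_left_mono enat_ord_simps(1) order_trans)
  have "ml_random U x \<and> optimal_constant U x \<le> c \<longleftrightarrow> randomness_constant U x c" for x
    unfolding ml_random_def optimal_constant_def using mono
    by (metis LeastI Least_le)
  then show ?thesis by (auto simp: random_left_ce_def)
qed

theorem theorem9:
  fixes U :: "bool list \<Rightarrow> bool list option" and c :: nat
  assumes "universal_prefix_free U"
  shows "\<not> (\<exists>r. effective_numbering r (random_left_ce U {0..c}))"
proof
  assume "\<exists>r. effective_numbering r (random_left_ce U {0..c})"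
  then obtain r where range: "range r = {x. left_ce x \<and> randomness_constant U x c}"
    and ce: "ce_dyadic_nat {(q, e). q \<in> dyadics \<and> q < real_of_seq (r e)}"
    unfolding effective_numbering_def random_left_ce_atLeastAtMost by blast
  have r: "randomness_constant U (r e) c" for e using range by auto
  let ?S = "random_reals U c"
  \<comment> \<open>A total map has nonempty range, so \<open>S\<close> is nonempty; this also
    settles those \<open>c\<close> for which the family is empty.\<close>
  have "real_of_seq (r 0) \<in> ?S" using r by (rule random_reals_I)
  then have "Sup ?S \<in> ?S" using Sup_random_reals_mem[OF assms] by blast
  then obtain x where x: "randomness_constant U x c" "Sup ?S = real_of_seq x"
    by (auto simp: random_reals_def)
  have max: "t \<le> real_of_seq x" if "t \<in> ?S" for t
    unfolding x(2)[symmetric] using that random_reals_bounds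
    by (intro cSup_upper bdd_aboveI[of _ 1])
  \<comment> \<open>The only use of surjectivity onto the family: the left-c.e. member found above
    \<open>n\<close> has an index.\<close>
  have below: "dyadic_of n < real_of_seq x \<longleftrightarrow> (\<exists>e. dyadic_of n \<le> 1 \<and> dyadic_of n < real_of_seq (r e))" for n
  proof
    assume n: "dyadic_of n < real_of_seq x"
    then obtain y where y: "left_ce y" "randomness_constant U y c" "dyadic_of n \<le> real_of_seq y"
      using left_ce_random_above[OF assms x(1), of n] by auto
    then obtain e where "y = r e" using range by blast
    moreover have "dyadic_of n < real_of_seq y"
      using y(3) dyadic_not_random[OF assms y(2), of n] by simp
    moreover have "dyadic_of n \<le> 1" using n real_of_seq_le_1[of x] by simp
    ultimately show "\<exists>e. dyadic_of n \<le> 1 \<and> dyadic_of n < real_of_seq (r e)" by blast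
  next
    assume "\<exists>e. dyadic_of n \<le> 1 \<and> dyadic_of n < real_of_seq (r e)"
    then show "dyadic_of n < real_of_seq x"
      using max[OF random_reals_I[OF r]] by (meson less_le_trans)
  qed
  \<comment> \<open>Above the maximum means that nothing of \<open>S\<close> remains up to 1.
    Rationals beyond 1 are split off, since \<open>cover_complete\<close> works inside the unit
    interval.\<close>
  have above: "real_of_seq x < dyadic_of n \<longleftrightarrow> dyadic_of (prod_encode (1, 0)) < dyadic_of n
      \<or> cover U c (dyadic_of n) (dyadic_of (prod_encode (1, 0)))" for n
  proof (cases "dyadic_of n \<le> 1")
    case True
    have "0 \<le> dyadic_of n" by (simp add: dyadic_of_def case_prod_beta)
    then have "cover U c (dyadic_of n) 1" if "real_of_seq x < dyadic_of n"
      using that True by (intro cover_complete) (auto dest: max)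
    moreover have "real_of_seq x < dyadic_of n" if "cover U c (dyadic_of n) 1"
      using cover_disjoint_random_reals[OF assms that] random_reals_I[OF x(1)] real_of_seq_le_1[of x]
      by (meson not_le)
    ultimately show ?thesis using True by auto
  next
    case False
    then show ?thesis using real_of_seq_le_1[of x] by auto
  qed
  have "semidecidable (\<lambda>m. dyadic_of (pfst m) \<le> 1 \<and> dyadic_of (pfst m) < real_of_seq (r (psnd m)))"
    using ce unfolding ce_dyadic_nat_def ce_iff_semidecidable
    by (rule back_subst[of semidecidable])
      (auto simp: fun_eq_iff dyadic_of_mem_dyadics, metis prod.collapse prod_decode_inverse)
  from semidecidable_ex[OF this] have "semidecidable (\<lambda>n. dyadic_of n < real_of_seq x)"
    unfolding below .
  moreover have "semidecidable (\<lambda>n. real_of_seq x < dyadic_of n)"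
    unfolding above using assms[unfolded universal_prefix_free_def]
    by (intro semidecidable_cover computability) auto
  ultimately show False using computable_real_not_random[OF assms] x(1) by blast
qed

end
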